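(* Let $S_I=\bigcap_{i=1}^{N_h}S_i$ and suppose that, for every $x\in S_I$, the transversality condition holds for the pair $(S_i,S_j)$ for all $i,j\in I(x)$. Consider the differential inclusion $\dot x(t)\in\widehat G_{\hat\gamma}(x(t))$. Let $x(\cdot)$ be any trajectory of this system under a Lebesgue measurable control input $u(\cdot)$ (i.e. $\dot x(t)=f(x(t))+g(x(t))u(t)$ with $u(t)\in\widehat K_{\hat\gamma}(x(t))$) with $x_0=x(0)\in\operatorname{int}(S_I\cap\widehat\Omega)$. Let $[0,T(x_0))$ be the (possibly empty) maximal interval such that $x(t)\in\operatorname{int}(\widehat\Omega)$ for all $t\in[0,T(x_0))$. Then $x(t)\in S_I$ for all $t\in[0,T(x_0))$.
   Context: System: $\dot x=f(x)+g(x)u$, $u\in\mathcal U\subset\mathbb R^m$, with $f:\mathbb R^n\to\mathbb R^n$ and $g:\mathbb R^n\to\mathbb R^{n\times m}$ locally Lipschitz. $\mathcal U=\{u\in\mathbb R^m: A_uu\le b_u\}$, with constant $A_u\in\mathbb R^{p\times m}$, $b_u\in\mathbb R^p$, is a compact convex polytope with nonempty interior. $\|\cdot\|$ is a sub-multiplicative matrix norm. Sets: for $i=1,\dots,N_h$, $h_i:\mathbb R^n\to\mathbb R$ is continuously differentiable with locally Lipschitz gradient; $S_i=\{x:h_i(x)\le0\}$ is compact, with $\operatorname{int}(S_i)=\{h_i<0\}$ and $\partial S_i=\{h_i=0\}$. Each $h_i$ is a strict control barrier function: $\inf_{u\in\mathcal U}[L_fh_i(x)+L_gh_i(x)u]<0$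 for all $x\in\partial S_i$, where $L_fh=\frac{\partial h}{\partial x}f$ and $L_gh=\frac{\partial h}{\partial x}g$. Maps: $\alpha_i:\mathbb R\to\mathbb R$ are locally Lipschitz extended class-$\mathcal K_\infty$ functions (continuous, strictly increasing, $\alpha_i(0)=0$, $\alpha_i(s)\to\pm\infty$ as $s\to\pm\infty$). Define $$\widehat K(x)=\{u\in\mathbb R^m: A_uu\le b_u,\ L_gh_i(x)u\le-\alpha_i(h_i(x))-L_fh_i(x),\ i=1,\dots,N_h\},$$ $\widehat\Omega=\{x\in\mathbb R^n:\operatorname{int}(\widehat K(x))\ne\emptyset\}$. For $A\subset\mathbb R^m$, $R_C(A)=\sup_{u\in A}d_{A^c}(u)$, where $A^c=\mathbb R^m\setminus A$ and $d_A(u)=\inf_{a\in A}\|u-a\|$. Fix a bounded open $D\subset\widehat\Omega$ and $\hat\gamma$ with $0<\hat\gamma<\inf_{x\in D}R_C(\widehat K(x))$. Define $\widehat K_{\hat\gamma}(x)=\operatorname{int}(\widehat K(x))-\hat\gamma B(0,1)=\{u\in\widehat K(x): d_{\mathbb R^m\setminus\widehat K(x)}(u)\ge\hat\gamma\}$ (Minkowski difference $U_1-U_2=(U_1^c+U_2)^c$, $B(0,1)$ the open unit ball), and $\widehat G_{\hat\gamma}(x)=\{f(x)+g(x)u:u\in\widehat K_{\hat\gamma}(x)\}$. Transversality: the Clarke tangent cone of $S$ at $x$ is $T_S(x)=\{v:\limsup_{y\to x,\,t\downarrow0}\frac{d_S(y+tv)-d_S(y)}{t}\le0\}$, and the normal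 cone is its polar, $N_S(x)=\{y:\langle y,v\rangle\le0\ \forall v\in T_S(x)\}$. Transversality holds for a pair $(S_1,S_2)$ of closed sets if $N_{S_1}(x)\cap(-N_{S_2}(x))=\{0\}$ for all $x\in\partial S_1\cap\partial S_2$. $I(x)=\{i:\exists j\ne i,\ h_i(x)=h_j(x)=0\}$. A trajectory is an absolutely continuous function satisfying the inclusion almost everywhere. *)

theory Defs
  imports "HOL-Analysis.Analysis"
begin

definition locally_lipschitz :: "('a::metric_space \<Rightarrow> 'b::metric_space) \<Rightarrow> bool" where
  "locally_lipschitz F \<longleftrightarrow> (\<forall>x. \<exists>r>0. \<exists>L. L-lipschitz_on (ball x r) F)"

definition ext_class_K_inf :: "(real \<Rightarrow> real) \<Rightarrow> bool" where
  "ext_class_K_inf \<alpha> \<longleftrightarrow> continuous_on UNIV \<alpha> \<and> strict_mono \<alpha> \<and> \<alpha> 0 = 0 \<and>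
     filterlim \<alpha> at_top at_top \<and> filterlim \<alpha> at_bot at_bot"

text \<open>The gradient; only meaningful at points of differentiability.\<close>
definition grad :: "(real^'n \<Rightarrow> real) \<Rightarrow> real^'n \<Rightarrow> real^'n" where
  "grad h x = (THE d. GDERIV h x :> d)"

definition C1_loc_lipschitz_grad :: "(real^'n \<Rightarrow> real) \<Rightarrow> bool" where
  "C1_loc_lipschitz_grad h \<longleftrightarrow>
     (\<forall>x. h differentiable at x) \<and> continuous_on UNIV (grad h) \<and> locally_lipschitz (grad h)"

definition Lie_f :: "(real^'n \<Rightarrow> real^'n) \<Rightarrow> (real^'n \<Rightarrow> real) \<Rightarrow> real^'n \<Rightarrow> real" where
  "Lie_f f h x = grad h x \<bullet> f x"

text \<open>The row vector obtained by multiplying the row gradient with the matrix \<open>g x\<close>.  It is applied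
  to an input \<open>u\<close> as \<open>Lie_g g h x \<bullet> u\<close>.\<close>
definition Lie_g :: "(real^'n \<Rightarrow> real^'m^'n) \<Rightarrow> (real^'n \<Rightarrow> real) \<Rightarrow> real^'n \<Rightarrow> real^'m" where
  "Lie_g g h x = grad h x v* g x"

definition polytope_ineq :: "real^'m^'p \<Rightarrow> real^'p \<Rightarrow> (real^'m) set" where
  "polytope_ineq A b = {u. \<forall>j. (A *v u) $ j \<le> b $ j}"

definition sublevel :: "('a \<Rightarrow> real) \<Rightarrow> 'a set" where
  "sublevel h = {x. h x \<le> 0}"

definition strict_cbf ::
  "(real^'m) set \<Rightarrow> (real^'n \<Rightarrow> real^'n) \<Rightarrow> (real^'n \<Rightarrow> real^'m^'n) \<Rightarrow> (real^'n \<Rightarrow> real) \<Rightarrow> bool" where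
  "strict_cbf U f g h \<longleftrightarrow>
     (\<forall>x \<in> frontier (sublevel h). (INF u\<in>U. Lie_f f h x + Lie_g g h x \<bullet> u) < 0)"

definition K_hat ::
  "real^'m^'p \<Rightarrow> real^'p \<Rightarrow> (real^'n \<Rightarrow> real^'n) \<Rightarrow> (real^'n \<Rightarrow> real^'m^'n) \<Rightarrow>
   nat \<Rightarrow> (nat \<Rightarrow> real^'n \<Rightarrow> real) \<Rightarrow> (nat \<Rightarrow> real \<Rightarrow> real) \<Rightarrow> real^'n \<Rightarrow> (real^'m) set" where
  "K_hat A b f g N h \<alpha> x =
     {u \<in> polytope_ineq A b. \<forall>i\<in>{1..N}. Lie_g g (h i) x \<bullet> u \<le> - \<alpha> i (h i x) - Lie_f f (h i) x}"

definition Omega_hat :: "(real^'n \<Rightarrow> (real^'m) set) \<Rightarrow> (real^'n) set" where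
  "Omega_hat K = {x. interior (K x) \<noteq> {}}"

text \<open>Values in \<open>ereal\<close>, so that suprema and infima over arbitrary sets have their usual meaning.
  \<open>infdist u {} = 0\<close> plays no role: the sets below are bounded, so their complements are nonempty.\<close>
definition R_C :: "(real^'m) set \<Rightarrow> ereal" where
  "R_C A = (SUP u\<in>A. ereal (infdist u (- A)))"

definition minkowski_diff :: "'a::real_vector set \<Rightarrow> 'a set \<Rightarrow> 'a set" where
  "minkowski_diff U V = - {a + b | a b. a \<in> - U \<and> b \<in> V}"

definition shrink :: "real \<Rightarrow> (real^'m) set \<Rightarrow> (real^'m) set" where
  "shrink \<gamma> K = minkowski_diff (interior K) ((\<lambda>b. \<gamma> *\<^sub>R b) ` ball 0 1)"

lemma shrink_eq:
  fixes K :: "(real^'m) set"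
  assumes "\<gamma> > 0" and "K \<noteq> UNIV"
  shows "shrink \<gamma> K = {u \<in> K. infdist u (- K) \<ge> \<gamma>}"
proof -
  have "u \<in> shrink \<gamma> K \<longleftrightarrow> u \<in> K \<and> infdist u (- K) \<ge> \<gamma>" for u
  proof -
    have "(\<lambda>b. \<gamma> *\<^sub>R b) ` ball 0 1 = ball (0::real^'m) \<gamma>"
      using ball_scale[of \<gamma> "0::real^'m" 1] assms(1) by simp
    then have "u \<in> shrink \<gamma> K \<longleftrightarrow> (\<forall>a b. a \<notin> interior K \<longrightarrow> norm b < \<gamma> \<longrightarrow> u \<noteq> a + b)"
      by (auto simp: shrink_def minkowski_diff_def)
    also have "\<dots> \<longleftrightarrow> ball u \<gamma> \<subseteq> interior K"
    proof
      assume *: "\<forall>a b. a \<notin> interior K \<longrightarrow> norm b < \<gamma> \<longrightarrow> u \<noteq> a + b"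
      show "ball u \<gamma> \<subseteq> interior K"
      proof
        fix a assume "a \<in> ball u \<gamma>"
        then have "norm (u - a) < \<gamma>" by (simp add: dist_norm)
        with *[rule_format, of a "u - a"] show "a \<in> interior K" by auto
      qed
    qed (auto simp: subset_eq dist_norm)
    also have "\<dots> \<longleftrightarrow> ball u \<gamma> \<subseteq> K"
      by (meson interior_maximal interior_subset open_ball subset_trans)
    also have "\<dots> \<longleftrightarrow> u \<in> K \<and> infdist u (- K) \<ge> \<gamma>"
    proof
      assume *: "ball u \<gamma> \<subseteq> K"
      then have "\<gamma> \<le> dist u a" if "a \<in> - K" for a
        using that by (meson ComplD mem_ball not_less subsetD)
      then have "\<gamma> \<le> infdist u (- K)"
        using assms(2) by (auto simp: infdist_def intro!: cINF_greatest)
      moreover have "u \<in> K" using * assms(1) by (auto simp: subset_eq)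
      ultimately show "u \<in> K \<and> infdist u (- K) \<ge> \<gamma>" by simp
    next
      assume *: "u \<in> K \<and> infdist u (- K) \<ge> \<gamma>"
      show "ball u \<gamma> \<subseteq> K"
      proof
        fix a assume "a \<in> ball u \<gamma>"
        then show "a \<in> K"
          using * infdist_le[of a "- K" u] by force
      qed
    qed
    finally show ?thesis .
  qed
  then show ?thesis by blast
qed

definition G_hat ::
  "(real^'n \<Rightarrow> real^'n) \<Rightarrow> (real^'n \<Rightarrow> real^'m^'n) \<Rightarrow> (real^'n \<Rightarrow> (real^'m) set) \<Rightarrow> real^'n \<Rightarrow> (real^'n) set"
  where "G_hat f g K x = (\<lambda>u. f x + g x *v u) ` K x"

definition clarke_tangent_cone :: "'a::euclidean_space set \<Rightarrow> 'a \<Rightarrow> 'a set" where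
  "clarke_tangent_cone S x =
     {v. Limsup (nhds x \<times>\<^sub>F at_right (0::real))
           (\<lambda>(y, t). ereal ((infdist (y + t *\<^sub>R v) S - infdist y S) / t)) \<le> 0}"

definition clarke_normal_cone :: "'a::euclidean_space set \<Rightarrow> 'a \<Rightarrow> 'a set" where
  "clarke_normal_cone S x = {y. \<forall>v \<in> clarke_tangent_cone S x. y \<bullet> v \<le> 0}"

definition transversal :: "'a::euclidean_space set \<Rightarrow> 'a set \<Rightarrow> bool" where
  "transversal S1 S2 \<longleftrightarrow>
     (\<forall>x \<in> frontier S1 \<inter> frontier S2.
        clarke_normal_cone S1 x \<inter> uminus ` clarke_normal_cone S2 x = {0})"

definition active_pairs :: "nat \<Rightarrow> (nat \<Rightarrow> 'a \<Rightarrow> real) \<Rightarrow> 'a \<Rightarrow> nat set" where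
  "active_pairs N h x = {i \<in> {1..N}. \<exists>j \<in> {1..N}. j \<noteq> i \<and> h i x = 0 \<and> h j x = 0}"

text \<open>The usual epsilon-delta absolute continuity: over a finite family of nonoverlapping compact
  subintervals (each \<open>k\<close> is \<open>{Inf k..Sup k}\<close>), small total length forces small total increment.\<close>
definition abs_continuous_on :: "real set \<Rightarrow> (real \<Rightarrow> 'a::real_normed_vector) \<Rightarrow> bool" where
  "abs_continuous_on I x \<longleftrightarrow>
     (\<forall>\<epsilon>>0. \<exists>\<delta>>0. \<forall>\<D> E. \<D> division_of E \<and> E \<subseteq> I \<and> (\<Sum>k\<in>\<D>. Sup k - Inf k) < \<delta> \<longrightarrow>
        (\<Sum>k\<in>\<D>. norm (x (Sup k) - x (Inf k))) < \<epsilon>)"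

text \<open>Trajectories live on an arbitrary interval \<open>J\<close> of nonnegative times with left endpoint 0
  (bounded or not, closed or not) and are absolutely continuous on its compact subintervals.\<close>
definition time_interval :: "real set \<Rightarrow> bool" where
  "time_interval J \<longleftrightarrow> is_interval J \<and> 0 \<in> J \<and> J \<subseteq> {0..}"

definition is_trajectory :: "(real^'n \<Rightarrow> (real^'n) set) \<Rightarrow> real set \<Rightarrow> (real \<Rightarrow> real^'n) \<Rightarrow> bool" where
  "is_trajectory G J x \<longleftrightarrow> time_interval J \<and>
     (\<forall>a b. {a..b} \<subseteq> J \<longrightarrow> abs_continuous_on {a..b} x) \<and>
     (AE t in lebesgue_on J. \<exists>v \<in> G (x t). (x has_vector_derivative v) (at t within J))"

definition is_trajectory_under ::
  "(real^'n \<Rightarrow> real^'n) \<Rightarrow> (real^'n \<Rightarrow> real^'m^'n) \<Rightarrow> (real^'n \<Rightarrow> (real^'m) set) \<Rightarrow>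
   real set \<Rightarrow> (real \<Rightarrow> real^'n) \<Rightarrow> (real \<Rightarrow> real^'m) \<Rightarrow> bool" where
  "is_trajectory_under f g K J x u \<longleftrightarrow>
     is_trajectory (G_hat f g K) J x \<and>
     u \<in> borel_measurable (lebesgue_on J) \<and>
     (AE t in lebesgue_on J. u t \<in> K (x t) \<and>
        (x has_vector_derivative (f (x t) + g (x t) *v u t)) (at t within J))"

text \<open>The right endpoint \<open>T\<close> of the maximal interval \<open>{0..<T}\<close> contained in \<open>J\<close> on which \<open>x\<close> stays in
  \<open>W\<close>; it may be 0 (empty interval) or infinite.\<close>
definition exit_time :: "real set \<Rightarrow> (real \<Rightarrow> 'a) \<Rightarrow> 'a set \<Rightarrow> ereal" where
  "exit_time J x W = Sup {ereal s | s. 0 \<le> s \<and> {0..<s} \<subseteq> J \<and> (\<forall>t\<in>{0..<s}. x t \<in> W)}"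

end

(* Along a trajectory each h_i (x t) is absolutely continuous and, since u t lies in K_hat (x t), its
   derivative is at most - alpha_i (h_i (x t)) almost everywhere. This is nonpositive wherever
   h_i (x t) \<ge> 0, so h_i (x t) cannot become positive after its last zero. *)
theory Submission
  imports Defs
begin

section \<open>Absolute continuity on an interval and its preservation under Lipschitz maps\<close>

lemma abs_continuous_onD:
  assumes "abs_continuous_on I x" and "\<epsilon> > 0"
  obtains \<delta> where "\<delta> > 0"
    and "\<And>\<D> S. \<D> division_of S \<Longrightarrow> S \<subseteq> I \<Longrightarrow> (\<Sum>k\<in>\<D>. Sup k - Inf k) < \<delta> \<Longrightarrow>
      (\<Sum>k\<in>\<D>. norm (x (Sup k) - x (Inf k))) < \<epsilon>"
  using assms unfolding abs_continuous_on_def by metis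

text \<open>The one-element division \<open>{{c..d}}\<close> already suffices. This form is what
  yields continuity.\<close>

lemma abs_continuous_onD_interval:
  fixes x :: "real \<Rightarrow> 'a::real_normed_vector"
  assumes "abs_continuous_on I x" and "\<epsilon> > 0"
  obtains \<delta> where "\<delta> > 0"
    and "\<And>c d. c \<le> d \<Longrightarrow> {c..d} \<subseteq> I \<Longrightarrow> d - c < \<delta> \<Longrightarrow> norm (x d - x c) < \<epsilon>"
proof -
  obtain \<delta> where "\<delta> > 0" and \<delta>: "\<And>\<D> E. \<D> division_of E \<Longrightarrow> E \<subseteq> I \<Longrightarrow>
      (\<Sum>k\<in>\<D>. Sup k - Inf k) < \<delta> \<Longrightarrow> (\<Sum>k\<in>\<D>. norm (x (Sup k) - x (Inf k))) < \<epsilon>"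
    using abs_continuous_onD[OF assms] by blast
  show thesis
  proof
    fix c d assume cd: "c \<le> d" "{c..d} \<subseteq> I" "d - c < \<delta>"
    have "{{c..d}} division_of {c..d}"
      using division_of_self[of c d] cd(1) by simp
    from \<delta>[OF this cd(2)] show "norm (x d - x c) < \<epsilon>" using cd by simp
  qed fact
qed

lemma abs_continuous_on_imp_continuous_on:
  fixes x :: "real \<Rightarrow> 'a::real_normed_vector"
  assumes "abs_continuous_on {a..b} x"
  shows "continuous_on {a..b} x"
proof -
  have "\<exists>d>0. \<forall>t\<in>{a..b}. dist t s < d \<longrightarrow> dist (x t) (x s) < e"
    if s: "s \<in> {a..b}" and "e > 0" for s e
  proof -
    obtain \<delta> where "\<delta> > 0" and \<delta>: "\<And>c d. c \<le> d \<Longrightarrow> {c..d} \<subseteq> {a..b} \<Longrightarrow> d - c < \<delta> \<Longrightarrow> norm (x d - x c) < e"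
      using abs_continuous_onD_interval[OF assms \<open>e > 0\<close>] by blast
    have "dist (x t) (x s) < e" if t: "t \<in> {a..b}" "dist t s < \<delta>" for t
      using \<delta>[of s t] \<delta>[of t s] s t by (cases "t \<le> s") (auto simp: dist_norm norm_minus_commute)
    then show ?thesis using \<open>\<delta> > 0\<close> by blast
  qed
  then show ?thesis unfolding continuous_on_iff by blast
qed

lemma abs_continuous_on_subset:
  "abs_continuous_on I x \<Longrightarrow> J \<subseteq> I \<Longrightarrow> abs_continuous_on J x"
  unfolding abs_continuous_on_def by (meson order_trans)

text \<open>\<open>F\<close> stretches each increment of \<open>x\<close> by a factor of at most
  \<open>L\<close>, so the \<delta> of \<open>x\<close> for a proportionally smaller tolerance
  serves the composition.\<close>

lemma abs_continuous_on_compose_lipschitz: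
  fixes x :: "real \<Rightarrow> 'a::real_normed_vector" and F :: "'a \<Rightarrow> 'b::real_normed_vector"
  assumes x: "abs_continuous_on I x" and F: "L-lipschitz_on X F" and xX: "x ` I \<subseteq> X"
  shows "abs_continuous_on I (\<lambda>t. F (x t))"
  unfolding abs_continuous_on_def
proof (intro allI impI)
  fix \<epsilon> :: real assume "\<epsilon> > 0"
  have L: "0 \<le> L" using F by (rule lipschitz_on_nonneg)
  \<comment> \<open>Dividing by \<open>L + 1\<close> rather than \<open>L\<close> covers the case
    \<open>L = 0\<close>.\<close>
  then have \<epsilon>: "\<epsilon> / (L + 1) > 0" using \<open>\<epsilon> > 0\<close> by simp
  obtain \<delta> where "\<delta> > 0" and \<delta>: "\<And>\<D> E. \<D> division_of E \<Longrightarrow> E \<subseteq> I \<Longrightarrow>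
      (\<Sum>k\<in>\<D>. Sup k - Inf k) < \<delta> \<Longrightarrow> (\<Sum>k\<in>\<D>. norm (x (Sup k) - x (Inf k))) < \<epsilon> / (L + 1)"
    using abs_continuous_onD[OF x \<epsilon>] by blast
  have "(\<Sum>k\<in>\<D>. norm (F (x (Sup k)) - F (x (Inf k)))) < \<epsilon>"
    if D: "\<D> division_of E" and E: "E \<subseteq> I" and len: "(\<Sum>k\<in>\<D>. Sup k - Inf k) < \<delta>" for \<D> E
  proof -
    have "(\<Sum>k\<in>\<D>. norm (F (x (Sup k)) - F (x (Inf k)))) \<le> (\<Sum>k\<in>\<D>. (L + 1) * norm (x (Sup k) - x (Inf k)))"
    proof (rule sum_mono)
      fix k assume k: "k \<in> \<D>"
      then obtain c d where cd: "k = {c..d}" "c \<le> d"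
        using division_ofD(3,4)[OF D k] by (metis atLeastatMost_empty_iff2 box_real(2))
      then have "c \<in> I" "d \<in> I"
        using division_ofD(2)[OF D k] E by auto
      then have "x c \<in> X" "x d \<in> X"
        using xX by auto
      then have "norm (F (x d) - F (x c)) \<le> L * norm (x d - x c)"
        using lipschitz_on_normD[OF F] by blast
      also have "\<dots> \<le> (L + 1) * norm (x d - x c)"
        by (rule mult_right_mono) auto
      finally show "norm (F (x (Sup k)) - F (x (Inf k))) \<le> (L + 1) * norm (x (Sup k) - x (Inf k))"
        using cd by simp
    qed
    also have "\<dots> = (L + 1) * (\<Sum>k\<in>\<D>. norm (x (Sup k) - x (Inf k)))"
      by (simp add: sum_distrib_left)
    also have "\<dots> < \<epsilon>"
      using \<delta>[OF D E len] L by (simp add: field_simps)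
    finally show ?thesis .
  qed
  then show "\<exists>\<delta>>0. \<forall>\<D> E. \<D> division_of E \<and> E \<subseteq> I \<and> (\<Sum>k\<in>\<D>. Sup k - Inf k) < \<delta> \<longrightarrow>
      (\<Sum>k\<in>\<D>. norm (F (x (Sup k)) - F (x (Inf k)))) < \<epsilon>"
    using \<open>\<delta> > 0\<close> by blast
qed

section \<open>Monotonicity from the sign of an almost everywhere derivative\<close>

text \<open>The intervals do not overlap, so their lengths add up to the measure of their union,
  which lies in \<open>V\<close>. This turns smallness of an open cover into the length bound that
  absolute continuity asks for.\<close>

lemma sum_content_tagged_partial_division_le:
  assumes p: "p tagged_partial_division_of {a..b::real}" and pV: "\<And>t k. (t, k) \<in> p \<Longrightarrow> k \<subseteq> V"
    and V: "V \<in> lmeasurable"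
  shows "(\<Sum>k\<in>snd ` p. Sup k - Inf k) \<le> measure lebesgue V"
proof -
  have div: "snd ` p division_of \<Union>(snd ` p)"
    by (rule division_of_tagged_division[OF tagged_partial_division_of_Union_self[OF p]])
  have "(\<Sum>k\<in>snd ` p. Sup k - Inf k) = (\<Sum>k\<in>snd ` p. measure lebesgue k)"
  proof (rule sum.cong[OF refl])
    fix k assume k: "k \<in> snd ` p"
    obtain c d where "k = {c..d}" "c \<le> d"
      using division_ofD(3,4)[OF div k] by (metis atLeastatMost_empty_iff2 box_real(2))
    then show "Sup k - Inf k = measure lebesgue k" by simp
  qed
  also have "\<dots> = measure lebesgue (\<Union>(snd ` p))"
    using content_division[OF div] by simp
  also have "\<dots> \<le> measure lebesgue V"
    using pV by (intro measure_mono_fmeasurable V lmeasurable_division[OF div, THEN fmeasurableD]) force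
  finally show ?thesis .
qed

(* The null set of bad points is enclosed in an open set V of small measure. In a division fine for
   the gauge below, intervals tagged outside E increase w by at most e times their length, and those
   tagged in E lie in V, so absolute continuity controls their total contribution. *)
lemma abs_continuous_on_nonincreasing:
  fixes w :: "real \<Rightarrow> real"
  assumes "a \<le> b" and ac: "abs_continuous_on {a..b} w" and E: "negligible E"
    and deriv: "\<And>t. t \<in> {a..b} - E \<Longrightarrow> \<exists>d\<le>0. (w has_real_derivative d) (at t within {a..b})"
  shows "w b \<le> w a"
proof -
  have "w b - w a \<le> 0 + e" if e: "e > 0" for e
  proof -
    \<comment> \<open>The slope allowed at good tags: over all of \<open>{a..b}\<close> it
      contributes at most \<open>e / 2\<close>. The \<open>+ 1\<close> keeps the denominator
      positive when \<open>a = b\<close>.\<close>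
    define e1 where "e1 = e / (2 * (b - a + 1))"
    have "e1 > 0" using e \<open>a \<le> b\<close> by (simp add: e1_def)
    have "e1 * (b - a) \<le> e / 2"
      using e \<open>a \<le> b\<close> by (simp add: e1_def field_simps)
    obtain \<delta> where "\<delta> > 0" and \<delta>: "\<And>\<D> S. \<D> division_of S \<Longrightarrow> S \<subseteq> {a..b} \<Longrightarrow>
      (\<Sum>k\<in>\<D>. Sup k - Inf k) < \<delta> \<Longrightarrow> (\<Sum>k\<in>\<D>. norm (w (Sup k) - w (Inf k))) < e / 2"
      using abs_continuous_onD[OF ac half_gt_zero[OF e]] by blast
    have Enull: "E \<in> null_sets lebesgue" using E by (simp add: negligible_iff_null_sets)
    then obtain V where V: "open V" "E \<subseteq> V" "V - E \<in> lmeasurable" "emeasure lebesgue (V - E) < ennreal \<delta>"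
      using sets_lebesgue_outer_open[of E \<delta>] \<open>\<delta> > 0\<close> by blast
    have "V = E \<union> (V - E)" using V(2) by blast
    have Vm: "V \<in> lmeasurable"
      using fmeasurable.Un[OF negligible_imp_measurable[OF E] V(3)] \<open>V = E \<union> (V - E)\<close> by simp
    have "measure lebesgue V = measure lebesgue (V - E)"
      using measure_Diff_null_set[OF fmeasurableD[OF Vm] Enull] by simp
    also have "\<dots> < \<delta>"
      using V(3,4) \<open>\<delta> > 0\<close> by (simp add: emeasure_eq_measure2 ennreal_less_iff)
    finally have mV: "measure lebesgue V < \<delta>" .
    \<comment> \<open>\<open>fit t r\<close> collects the demands on the gauge radius at
      \<open>t\<close> for bad and good tags alike, so that a single choice function gives the
      gauge.\<close>
    define fit where "fit t r \<longleftrightarrow> r > 0 \<and> (t \<in> E \<longrightarrow> ball t r \<subseteq> V) \<and>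
        (t \<in> {a..b} - E \<longrightarrow> (\<forall>p q. {p..q} \<subseteq> {a..b} \<inter> ball t r \<longrightarrow> t \<in> {p..q} \<longrightarrow> w q - w p \<le> e1 * (q - p)))"
      for t r
    have "\<exists>r. fit t r" for t
    proof (cases "t \<in> E")
      case True
      then obtain r where "r > 0" "ball t r \<subseteq> V"
        using V(1,2) open_contains_ball by blast
      then show ?thesis using True by (auto simp: fit_def)
    next
      case tE: False
      show ?thesis
      proof (cases "t \<in> {a..b}")
        case True
        then obtain d where "d \<le> 0" and "(w has_real_derivative d) (at t within {a..b})"
          using deriv tE by blast
        then have "\<exists>r>0. \<forall>y\<in>{a..b}. \<bar>y - t\<bar> < r \<longrightarrow> \<bar>w y - w t - d * (y - t)\<bar> \<le> e1 * \<bar>y - t\<bar>"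
          using \<open>e1 > 0\<close> unfolding has_field_derivative_def has_derivative_within_alt real_norm_def
          by blast
        then obtain r where "r > 0" and r: "\<And>y. y \<in> {a..b} \<Longrightarrow> \<bar>y - t\<bar> < r \<Longrightarrow>
            \<bar>w y - w t - d * (y - t)\<bar> \<le> e1 * \<bar>y - t\<bar>"
          by blast
        have "w q - w p \<le> e1 * (q - p)"
          if pq: "{p..q} \<subseteq> {a..b} \<inter> ball t r" and t: "t \<in> {p..q}" for p q
        proof -
          have "p \<in> {p..q}" "q \<in> {p..q}" using t by auto
          then have "p \<in> {a..b}" "q \<in> {a..b}" "\<bar>p - t\<bar> < r" "\<bar>q - t\<bar> < r"
            using pq by (auto simp: dist_real_def)
          then have *: "\<bar>w p - w t - d * (p - t)\<bar> \<le> e1 * (t - p)" "\<bar>w q - w t - d * (q - t)\<bar> \<le> e1 * (q - t)"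
            using r[of p] r[of q] t by auto
          \<comment> \<open>Since \<open>t\<close> lies between \<open>p\<close> and
            \<open>q\<close>, the linear terms on both sides of \<open>t\<close> have a favourable
            sign, and only the errors \<open>e1 * (t - p)\<close> and \<open>e1 * (q - t)\<close>
            remain. They add up to \<open>e1 * (q - p)\<close>.\<close>
          have "d * (q - t) \<le> 0" "0 \<le> d * (p - t)"
            using \<open>d \<le> 0\<close> t by (auto simp: mult_nonpos_nonneg mult_nonpos_nonpos)
          then show ?thesis using * by (simp add: algebra_simps abs_le_iff)
        qed
        then have "fit t r" using \<open>r > 0\<close> tE by (simp add: fit_def)
        then show ?thesis ..
      \<comment> \<open>Outside both \<open>E\<close> and \<open>{a..b}\<close> nothing is demanded,
        so any positive radius serves.\<close>
      qed (use tE in \<open>auto simp: fit_def intro!: exI[of _ 1]\<close>)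
    qed
    then obtain r where "\<And>t. fit t (r t)" by metis
    then have r0: "\<And>t. r t > 0" and rE: "\<And>t. t \<in> E \<Longrightarrow> ball t (r t) \<subseteq> V"
      and rw: "\<And>t p q. t \<in> {a..b} - E \<Longrightarrow> {p..q} \<subseteq> {a..b} \<inter> ball t (r t) \<Longrightarrow> t \<in> {p..q} \<Longrightarrow> w q - w p \<le> e1 * (q - p)"
      unfolding fit_def by blast+
    have "gauge (\<lambda>t. ball t (r t))" using r0 by (simp add: gauge_def)
    then obtain p where p: "p tagged_division_of {a..b}" and fine: "(\<lambda>t. ball t (r t)) fine p"
      using fine_division_exists_real by blast
    \<comment> \<open>\<open>p1\<close> is the part of the division whose tags are bad
      points.\<close>
    define p1 where "p1 = {z \<in> p. fst z \<in> E}"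
    have fin: "finite p" using p by blast
    have p1: "p1 tagged_partial_division_of {a..b}"
      using p by (auto simp: p1_def tagged_division_of_def intro: tagged_partial_division_subset)
    define \<phi> where "\<phi> k = w (Sup k) - w (Inf k)" for k
    have interval: "\<exists>c d. k = {c..d} \<and> c \<le> d \<and> t \<in> {c..d} \<and> {c..d} \<subseteq> {a..b} \<inter> ball t (r t) \<and> t \<in> {a..b}"
      if tk: "(t, k) \<in> p" for t k
    proof -
      obtain c d where "k = {c..d}" using tagged_division_ofD(4)[OF p tk] by auto
      then show ?thesis
        using tagged_division_ofD(2,3)[OF p tk] fine tk unfolding fine_def by fastforce
    qed
    have "w b - w a = (\<Sum>(t,k)\<in>p. \<phi> k)"
      using additive_tagged_division_1[OF \<open>a \<le> b\<close> p, of w] by (simp add: \<phi>_def)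
    also have "\<dots> = (\<Sum>(t,k)\<in>p1. \<phi> k) + (\<Sum>(t,k)\<in>p - p1. \<phi> k)"
      using sum.subset_diff[of p1 p] fin by (auto simp: p1_def add.commute)
    also have "(\<Sum>(t,k)\<in>p - p1. \<phi> k) \<le> e / 2"
    proof -
      have "(\<Sum>(t,k)\<in>p - p1. \<phi> k) \<le> (\<Sum>(t,k)\<in>p - p1. e1 * Sup k - e1 * Inf k)"
      proof (rule sum_mono, clarify)
        fix t k assume tk: "(t, k) \<in> p" "(t, k) \<notin> p1"
        then show "\<phi> k \<le> e1 * Sup k - e1 * Inf k"
          using interval[OF tk(1)] rw[of t] by (auto simp: p1_def \<phi>_def right_diff_distrib)
      qed
      \<comment> \<open>Restoring the terms of \<open>p1\<close>, which are nonnegative, makes the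
        sum run over a full division of \<open>{a..b}\<close>, where it telescopes.\<close>
      also have "\<dots> \<le> (\<Sum>(t,k)\<in>p. e1 * Sup k - e1 * Inf k)"
        using interval \<open>e1 > 0\<close> by (intro sum_mono2 fin) fastforce+
      also have "\<dots> = e1 * b - e1 * a"
        by (rule additive_tagged_division_1[OF \<open>a \<le> b\<close> p, of "\<lambda>s. e1 * s"])
      also have "\<dots> \<le> e / 2" using \<open>e1 * (b - a) \<le> e / 2\<close> by (simp add: right_diff_distrib)
      finally show ?thesis .
    qed
    also have "(\<Sum>(t,k)\<in>p1. \<phi> k) \<le> e / 2"
    proof -
      have "(\<Sum>(t,k)\<in>p1. \<phi> k) \<le> (\<Sum>(t,k)\<in>p1. norm (\<phi> k))"
        by (rule sum_mono) auto
      also have "\<dots> = (\<Sum>k\<in>snd ` p1. norm (\<phi> k))"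
      proof -
        \<comment> \<open>Absolute continuity speaks of a set of intervals, while \<open>p1\<close>
          consists of tagged ones. An interval that occurs with two tags has empty interior, hence
          is a single point with zero increment, so forgetting tags leaves the sum
          unchanged.\<close>
        have "norm (\<phi> (snd z)) = 0"
          if z: "z \<in> p1" "z' \<in> p1" "z \<noteq> z'" "snd z = snd z'" for z z'
        proof -
          obtain t t' k where zz: "z = (t, k)" "z' = (t', k)" using z(4) by (cases z, cases z') auto
          then have "interior k = {}"
            using tagged_partial_division_ofD(5)[OF p1, of t k t' k] z by auto
          moreover obtain c d where "k = {c..d}" "c \<le> d"
            using interval[of t k] z(1) zz by (auto simp: p1_def)
          ultimately have "c = d" by auto
          then show ?thesis using zz \<open>k = {c..d}\<close> by (simp add: \<phi>_def)
        qed
        then show ?thesis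
          using fin by (subst sum.reindex_nontrivial) (auto simp: p1_def split_def)
      qed
      also have "\<dots> < e / 2"
        unfolding \<phi>_def
      proof (rule \<delta>)
        show "snd ` p1 division_of \<Union>(snd ` p1)"
          by (rule division_of_tagged_division[OF tagged_partial_division_of_Union_self[OF p1]])
        show "\<Union>(snd ` p1) \<subseteq> {a..b}"
          using interval by (force simp: p1_def)
        have sub: "k \<subseteq> V" if "(t, k) \<in> p1" for t k
          using that interval[of t k] rE[of t] by (auto simp: p1_def)
        have "(\<Sum>k\<in>snd ` p1. Sup k - Inf k) \<le> measure lebesgue V"
          by (rule sum_content_tagged_partial_division_le[OF p1 _ Vm]) (rule sub)
        then show "(\<Sum>k\<in>snd ` p1. Sup k - Inf k) < \<delta>" using mV by simp
      qed
      finally show ?thesis by simp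
    qed
    finally show ?thesis by simp
  qed
  then have "w b - w a \<le> 0" by (rule field_le_epsilon)
  then show ?thesis by simp
qed

section \<open>Gradients and Lipschitz bounds on balls\<close>

lemma has_derivative_grad:
  fixes h :: "real^'n \<Rightarrow> real"
  assumes "h differentiable at x"
  shows "(h has_derivative (\<lambda>v. grad h x \<bullet> v)) (at x)"
proof -
  obtain F where F: "(h has_derivative F) (at x)"
    using assms unfolding differentiable_def by blast
  then have "linear F" by (rule has_derivative_linear)
  \<comment> \<open>\<open>adjoint F 1\<close> is the Riesz vector of the functional
    \<open>F\<close>. It witnesses existence for the definite description in
    \<open>grad\<close>.\<close>
  then have "F = (\<lambda>v. v \<bullet> adjoint F 1)"
    using adjoint_works[of F _ 1] by (auto simp: inner_commute)
  with F have ex: "GDERIV h x :> adjoint F 1" by (simp add: gderiv_def)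
  have "d = d'" if "GDERIV h x :> d" "GDERIV h x :> d'" for d d'
  proof -
    have "(\<lambda>v. v \<bullet> d) = (\<lambda>v. v \<bullet> d')"
      using that unfolding gderiv_def by (rule has_derivative_unique)
    then show ?thesis by (metis inner_commute vector_eq_rdot)
  qed
  with ex have "GDERIV h x :> grad h x" unfolding grad_def by (blast intro: theI')
  then show ?thesis by (simp add: gderiv_def inner_commute)
qed

text \<open>The continuous gradient is bounded on the compact ball, and the ball is convex, so the
  mean value inequality makes that bound a Lipschitz constant.\<close>

lemma C1_lipschitz_on_cball:
  fixes h :: "real^'n \<Rightarrow> real"
  assumes h: "C1_loc_lipschitz_grad h"
  obtains L where "L-lipschitz_on (cball c r) h"
proof -
  have "compact (grad h ` cball c r)"
    using h by (intro compact_continuous_image) (auto simp: C1_loc_lipschitz_grad_def intro: continuous_on_subset)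
  then obtain B where B: "B > 0" "\<And>y. y \<in> cball c r \<Longrightarrow> norm (grad h y) \<le> B"
    using compact_imp_bounded bounded_pos by (metis imageI)
  have "B-lipschitz_on (cball c r) h"
  proof (rule bounded_derivative_imp_lipschitz)
    show "(h has_derivative (\<lambda>v. grad h y \<bullet> v)) (at y within cball c r)" for y
      using h by (auto simp: C1_loc_lipschitz_grad_def intro!: has_derivative_at_withinI has_derivative_grad)
    show "onorm (\<lambda>v. grad h y \<bullet> v) \<le> B" if "y \<in> cball c r" for y
    proof (rule onorm_bound)
      show "norm (grad h y \<bullet> v) \<le> B * norm v" for v
        using Cauchy_Schwarz_ineq2[of "grad h y" v] B(2)[OF that]
        by (metis real_norm_def mult_right_mono norm_ge_zero order_trans)
    qed (use B in auto)
  qed (use B in auto)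
  then show thesis ..
qed

section \<open>Admissible inputs and the derivative along the dynamics\<close>

text \<open>The scaled ball contains \<open>0\<close>, so a point outside \<open>K\<close> is itself
  one of the sums that the Minkowski difference removes.\<close>

lemma shrink_subset:
  fixes K :: "(real^'m) set"
  shows "shrink \<gamma> K \<subseteq> K"
proof
  fix u assume u: "u \<in> shrink \<gamma> K"
  show "u \<in> K"
  proof (rule ccontr)
    assume "u \<notin> K"
    then have "u \<in> - interior K" using interior_subset by blast
    moreover have "(0::real^'m) \<in> (\<lambda>b. \<gamma> *\<^sub>R b) ` ball 0 1" by (rule image_eqI[of _ _ 0]) auto
    moreover have "u = u + 0" by simp
    ultimately show False using u unfolding shrink_def minkowski_diff_def by blast
  qed
qed

text \<open>The barrier constraint in \<open>K_hat\<close> with its two Lie derivatives regrouped,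
  by moving \<open>g y\<close> across the inner product, into the derivative of \<open>h i\<close>
  along the controlled vector field.\<close>

lemma K_hat_derivative_le:
  assumes "v \<in> K_hat A b f g N h \<alpha> y" and "i \<in> {1..N}"
  shows "grad (h i) y \<bullet> (f y + g y *v v) \<le> - \<alpha> i (h i y)"
  using assms unfolding K_hat_def Lie_f_def Lie_g_def
  by (fastforce simp: dot_lmul_matrix inner_add_right)

section \<open>Last zeros and invariance of the safe set\<close>

text \<open>The zero set is compact, and nonempty by the intermediate value theorem, so it has a
  largest element \<open>s\<close>. A negative value after \<open>s\<close> would force a still
  later zero, because \<open>w b\<close> is positive.\<close>

lemma last_zero:
  fixes w :: "real \<Rightarrow> real"
  assumes "a \<le> b" and w: "continuous_on {a..b} w" and "w a \<le> 0" and "0 < w b"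
  obtains s where "s \<in> {a..b}" and "w s = 0" and "\<And>t. t \<in> {s..b} \<Longrightarrow> 0 \<le> w t"
proof -
  define Z where "Z = {t \<in> {a..b}. w t = 0}"
  have ivt: "\<exists>t\<ge>c. t \<le> b \<and> w t = 0" if "c \<in> {a..b}" "w c \<le> 0" for c
    using that assms by (intro IVT') (auto intro: continuous_on_subset)
  have "closed Z"
    unfolding Z_def using w by (intro continuous_closed_preimage_constant) auto
  then have "compact Z"
    using closed_Int_compact[OF _ compact_Icc, of Z a b] by (simp add: Int_absorb2 Z_def subset_eq)
  moreover have "Z \<noteq> {}"
    using ivt[of a] assms unfolding Z_def by auto
  ultimately obtain s where s: "s \<in> Z" "\<And>t. t \<in> Z \<Longrightarrow> t \<le> s"
    by (metis compact_attains_sup)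
  show thesis
  proof
    fix t assume t: "t \<in> {s..b}"
    show "0 \<le> w t"
    proof (rule ccontr)
      assume "\<not> 0 \<le> w t"
      moreover have "t \<in> {a..b}" using t s by (auto simp: Z_def)
      ultimately obtain t' where "t' \<ge> t" "t' \<le> b" "w t' = 0" using ivt[of t] by auto
      then have "t' \<in> Z" using \<open>t \<in> {a..b}\<close> by (auto simp: Z_def)
      then have "t = s" using s(2)[of t'] t \<open>t \<le> t'\<close> by auto
      then show False using s(1) \<open>\<not> 0 \<le> w t\<close> by (simp add: Z_def)
    qed
  qed (use s in \<open>auto simp: Z_def\<close>)
qed

theorem theorem4:
  fixes f :: "real^'n \<Rightarrow> real^'n"
    and g :: "real^'n \<Rightarrow> real^'m^'n"
    and A :: "real^'m^'p" and b :: "real^'p"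
    and N :: nat
    and h :: "nat \<Rightarrow> real^'n \<Rightarrow> real"
    and \<alpha> :: "nat \<Rightarrow> real \<Rightarrow> real"
    and D :: "(real^'n) set" and \<gamma> :: real
    and J :: "real set" and x :: "real \<Rightarrow> real^'n" and u :: "real \<Rightarrow> real^'m"
  assumes "locally_lipschitz f" and "locally_lipschitz g"
    and "compact (polytope_ineq A b)" and "interior (polytope_ineq A b) \<noteq> {}"
    and "\<And>i. i \<in> {1..N} \<Longrightarrow> C1_loc_lipschitz_grad (h i)"
    and "\<And>i. i \<in> {1..N} \<Longrightarrow> compact (sublevel (h i))"
    and "\<And>i. i \<in> {1..N} \<Longrightarrow> interior (sublevel (h i)) = {y. h i y < 0}"
    and "\<And>i. i \<in> {1..N} \<Longrightarrow> frontier (sublevel (h i)) = {y. h i y = 0}"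
    and "\<And>i. i \<in> {1..N} \<Longrightarrow> strict_cbf (polytope_ineq A b) f g (h i)"
    and "\<And>i. i \<in> {1..N} \<Longrightarrow> locally_lipschitz (\<alpha> i)"
    and "\<And>i. i \<in> {1..N} \<Longrightarrow> ext_class_K_inf (\<alpha> i)"
    and "bounded D" and "open D" and "D \<subseteq> Omega_hat (K_hat A b f g N h \<alpha>)"
    and "0 < \<gamma>" and "ereal \<gamma> < (INF y\<in>D. R_C (K_hat A b f g N h \<alpha> y))"
    and "\<forall>y \<in> (\<Inter>i\<in>{1..N}. sublevel (h i)). \<forall>i \<in> active_pairs N h y. \<forall>j \<in> active_pairs N h y.
           transversal (sublevel (h i)) (sublevel (h j))"
    and "is_trajectory_under f g (\<lambda>y. shrink \<gamma> (K_hat A b f g N h \<alpha> y)) J x u"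
    and "x 0 \<in> interior ((\<Inter>i\<in>{1..N}. sublevel (h i)) \<inter> Omega_hat (K_hat A b f g N h \<alpha>))"
  shows "\<forall>t\<ge>0. ereal t < exit_time J x (interior (Omega_hat (K_hat A b f g N h \<alpha>))) \<longrightarrow>
           x t \<in> (\<Inter>i\<in>{1..N}. sublevel (h i))"
proof (intro allI impI INT_I)
  fix t i assume "0 \<le> t" and i: "i \<in> {1..N}"
    and "ereal t < exit_time J x (interior (Omega_hat (K_hat A b f g N h \<alpha>)))"
  \<comment> \<open>Some \<open>s\<close> beyond \<open>t\<close> belongs to the set whose supremum
    is the exit time, and \<open>{0..<s}\<close> contains the closed interval
    \<open>{0..t}\<close>.\<close>
  then have tJ: "{0..t} \<subseteq> J"
    unfolding exit_time_def less_Sup_iff by fastforce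
  note h = assms(5)[OF i] and traj = assms(18)[unfolded is_trajectory_under_def is_trajectory_def]
  have "0 \<le> \<alpha> i r" if "0 \<le> r" for r
    using assms(11)[OF i] that unfolding ext_class_K_inf_def by (metis strict_mono_less_eq)
  then have \<alpha>: "d \<le> 0" if "d \<le> - \<alpha> i r" "0 \<le> r" for d r
    using that by force
  \<comment> \<open>Measurability of \<open>J\<close> allows the almost everywhere statement on
    \<open>J\<close> to be read on the whole line, which gives a null set \<open>E\<close> of
    exceptional times.\<close>
  have J: "J \<in> sets lebesgue"
    using traj by (auto simp: time_interval_def intro!: sets_completionI_sets real_interval_borel_measurable)
  define good where "good s \<longleftrightarrow> u s \<in> shrink \<gamma> (K_hat A b f g N h \<alpha> (x s)) \<and>
      (x has_vector_derivative (f (x s) + g (x s) *v u s)) (at s within J)" for s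
  have "AE s in lebesgue_on J. good s"
    using traj unfolding good_def by blast
  then have "AE s in lebesgue. s \<in> J \<longrightarrow> good s"
    using J by (simp add: AE_restrict_space_iff)
  then obtain E where E: "\<And>s. s \<in> space lebesgue - E \<Longrightarrow> s \<in> J \<longrightarrow> good s"
    and "E \<in> null_sets lebesgue"
    by (rule AE_E3) blast
  then have "negligible E" by (simp add: negligible_iff_null_sets)

  have x: "abs_continuous_on {0..t} x" using traj tJ by blast
  then have "bounded (x ` {0..t})"
    by (intro compact_imp_bounded compact_continuous_image abs_continuous_on_imp_continuous_on) auto
  \<comment> \<open>The path up to time \<open>t\<close> is enclosed in one ball, on which
    \<open>h i\<close> has a single Lipschitz constant.\<close>
  then obtain c r where r: "x ` {0..t} \<subseteq> cball c r"
    unfolding bounded_subset_cball by blast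
  obtain L where L: "L-lipschitz_on (cball c r) (h i)"
    using C1_lipschitz_on_cball[OF h] by blast
  define w where "w s = h i (x s)" for s
  have w: "abs_continuous_on {0..t} w"
    unfolding w_def by (rule abs_continuous_on_compose_lipschitz[OF x L r])

  have "w t \<le> 0"
  proof (rule ccontr)
    assume "\<not> w t \<le> 0"
    have "w 0 \<le> 0"
      using subsetD[OF interior_subset assms(19)] i by (auto simp: w_def sublevel_def)
    then obtain s where s: "s \<in> {0..t}" "w s = 0" and pos: "\<And>\<tau>. \<tau> \<in> {s..t} \<Longrightarrow> 0 \<le> w \<tau>"
      using last_zero[OF \<open>0 \<le> t\<close> abs_continuous_on_imp_continuous_on[OF w]] \<open>\<not> w t \<le> 0\<close>
      by (metis not_le)
    \<comment> \<open>On \<open>{s..t}\<close> the function \<open>w\<close> is nonnegative, so the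
      barrier inequality gives a nonpositive derivative off \<open>E\<close>. Thus \<open>w\<close>
      cannot rise from its zero at \<open>s\<close> to a positive value at \<open>t\<close>.\<close>
    have "w t \<le> w s"
    proof (rule abs_continuous_on_nonincreasing[where w = w and a = s and b = t, OF _ _ \<open>negligible E\<close>])
      show "s \<le> t" "abs_continuous_on {s..t} w"
        using s by (auto intro: abs_continuous_on_subset[OF w])
      fix \<tau> assume \<tau>: "\<tau> \<in> {s..t} - E"
      have sub: "{s..t} \<subseteq> J" using s tJ by auto
      define v where "v = f (x \<tau>) + g (x \<tau>) *v u \<tau>"
      have u: "u \<tau> \<in> K_hat A b f g N h \<alpha> (x \<tau>)"
        \<comment> \<open>The derivative of the trajectory is taken within \<open>J\<close> and
          restricts to the subinterval \<open>{s..t}\<close>, also at its endpoints.\<close>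
        and xv: "(x has_derivative (\<lambda>y. y *\<^sub>R v)) (at \<tau> within {s..t})"
        using E[of \<tau>] \<tau> sub shrink_subset
        by (auto simp: good_def v_def has_vector_derivative_def intro: has_derivative_subset)
      have "(h i has_derivative (\<lambda>y. grad (h i) (x \<tau>) \<bullet> y)) (at (x \<tau>))"
        using h by (intro has_derivative_grad) (simp add: C1_loc_lipschitz_grad_def)
      from has_derivative_compose[OF xv this]
      have "(w has_derivative (\<lambda>y. grad (h i) (x \<tau>) \<bullet> (y *\<^sub>R v))) (at \<tau> within {s..t})"
        unfolding w_def .
      then have "(w has_real_derivative grad (h i) (x \<tau>) \<bullet> v) (at \<tau> within {s..t})"
        by (simp add: has_field_derivative_def mult_commute_abs)
      moreover have "grad (h i) (x \<tau>) \<bullet> v \<le> 0"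
        using \<alpha>[OF K_hat_derivative_le[OF u i]] pos[of \<tau>] \<tau> by (simp add: v_def w_def)
      ultimately show "\<exists>d\<le>0. (w has_real_derivative d) (at \<tau> within {s..t})" by blast
    qed
    then show False using s(2) \<open>\<not> w t \<le> 0\<close> by simp
  qed
  then show "x t \<in> sublevel (h i)" by (simp add: w_def sublevel_def)
qed

end
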